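(* Let $n\ge1$ and $\rho_0,\rho_1 \in [0,1)$. Let $f:\mathbb{F}_2^n\to \{\pm 1\}$ be a Boolean function (not necessarily unbiased). Then $$D\big(P_{f(X^n)f(Y^n),\rho_0} \,\big\|\, P_{f(X^n)f(Y^n),\rho_1}\big) \le \max_{1 \le k \le n} d\bigg(\frac{1+\rho_0^k}{2} \,\bigg\|\, \frac{1+\rho_1^k}{2}\bigg).$$ Furthermore, for $g=-f$, $$D\big(P_{f(X^n)g(Y^n),\rho_0} \,\big\|\, P_{f(X^n)g(Y^n),\rho_1}\big) \le \max_{1 \le k \le n} d\bigg(\frac{1+\rho_0^k}{2} \,\bigg\|\, \frac{1+\rho_1^k}{2}\bigg).$$
   Context: $\mathbb{F}_2=\{0,1\}$. For $\rho\in[-1,1]$, a pair $(X^n,Y^n)$ of random vectors in $\mathbb{F}_2^n$ is called $\rho$-correlated if $X^n$ is uniform on $\mathbb{F}_2^n$ and, independently for each $i\in\{1,\dots,n\}$, $Y_i=X_i$ with probability $\frac{1+\rho}{2}$ and $Y_i=X_i+1$ with probability $\frac{1-\rho}{2}$. For functions $f,g:\mathbb{F}_2^n\to\{\pm1\}$, $P_{f(X^n)g(Y^n),\rho}$ denotes the joint distribution on $\{\pm1\}^2$ of $(f(X^n),g(Y^n))$ when $(X^n,Y^n)$ is $\rho$-correlated. $D(P\|Q)=\sum_z P(z)\ln\frac{P(z)}{Q(z)}$ is the Kullback-Leibler divergence (with the usual convention that terms with $P(z)=0$ are $0$), and $d(p\|q)=p\ln\frac{p}{q}+(1-p)\ln\frac{1-p}{1-q}$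 is the binary divergence. *)

theory Defs
  imports
    "HOL-Probability.Probability"
    "HOL-Library.Z2"
begin

text \<open>
  The space $\mathbb{F}_2^n$ is rendered as \<^typ>\<open>bit ^ 'n\<close>, where \<^typ>\<open>bit\<close> is the two-element
  field and $n$ is \<^term>\<open>CARD('n)\<close>. The library does not declare \<^typ>\<open>bit\<close> to be finite.
\<close>

instance bit :: finite
proof
  have "(UNIV :: bit set) = {0, 1}"
    by (auto intro: bit.exhaust)
  then show "finite (UNIV :: bit set)"
    by (metis finite.emptyI finite.insertI)
qed

definition noisy_bit :: "real \<Rightarrow> bit \<Rightarrow> bit pmf" where
  "noisy_bit \<rho> b = map_pmf (\<lambda>keep. if keep then b else b + 1) (bernoulli_pmf ((1 + \<rho>) / 2))"

definition correlated_pair :: "real \<Rightarrow> ((bit ^ 'n) \<times> (bit ^ 'n)) pmf" where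
  "correlated_pair \<rho> =
     bind_pmf (pmf_of_set UNIV) (\<lambda>x.
     bind_pmf (Pi_pmf UNIV 0 (\<lambda>i. noisy_bit \<rho> (x $ i))) (\<lambda>y.
     return_pmf (x, vec_lambda y)))"

definition joint_law ::
  "(bit ^ 'n \<Rightarrow> real) \<Rightarrow> (bit ^ 'n \<Rightarrow> real) \<Rightarrow> real \<Rightarrow> (real \<times> real) pmf" where
  "joint_law f g \<rho> = map_pmf (\<lambda>(x, y). (f x, g y)) (correlated_pair \<rho>)"

text \<open>
  The library's \<^const>\<open>KL_divergence\<close> takes the reference measure first, so the arguments are
  swapped, and base \<^term>\<open>exp 1 :: real\<close> gives natural logarithms. It is real-valued and is only
  meaningful if \<^term>\<open>P\<close> is absolutely continuous with respect to \<^term>\<open>Q\<close>; this is always the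
  case below, by \<open>set_pmf_joint_law\<close>.
\<close>

definition KL_div :: "'a pmf \<Rightarrow> 'a pmf \<Rightarrow> real" where
  "KL_div P Q = KL_divergence (exp 1) (measure_pmf Q) (measure_pmf P)"

definition binary_KL_div :: "real \<Rightarrow> real \<Rightarrow> real" where
  "binary_KL_div p q = p * ln (p / q) + (1 - p) * ln ((1 - p) / (1 - q))"

lemma KL_div_eq_sum:
  assumes "finite A" and "set_pmf P \<subseteq> A" and ac: "set_pmf P \<subseteq> set_pmf Q"
  shows "KL_div P Q = (\<Sum>z\<in>A. pmf P z * ln (pmf P z / pmf Q z))"
proof -
  let ?r = "\<lambda>z. pmf P z / pmf Q z"
  have Q: "sigma_finite_measure (measure_pmf Q)"
    by (intro prob_space_imp_sigma_finite prob_space_measure_pmf)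
  have zero: "pmf P z = 0" if "pmf Q z = 0" for z
    using ac that by (auto simp: set_pmf_iff)
  have cancel: "pmf Q z * ?r z = pmf P z" for z
    by (cases "pmf Q z = 0") (simp_all add: zero)
  have "density (measure_pmf Q) (\<lambda>z. ennreal (?r z)) = measure_pmf P"
    unfolding measure_pmf_eq_density
    by (subst density_density_eq)
       (auto simp: cancel zero AE_count_space simp flip: ennreal_mult intro!: density_cong)
  then have "KL_div P Q = (\<integral>z. ?r z * log (exp 1) (?r z) \<partial>measure_pmf Q)"
    unfolding KL_div_def using sigma_finite_measure.KL_density[OF Q, of "exp 1" ?r] by simp
  also have "\<dots> = (\<Sum>z\<in>A. ?r z * log (exp 1) (?r z) * pmf Q z)"
    using assms by (intro integral_measure_pmf_real) (auto simp: set_pmf_iff)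
  also have "\<dots> = (\<Sum>z\<in>A. pmf P z * ln (?r z))"
  proof (intro sum.cong refl)
    fix z
    show "?r z * log (exp 1) (?r z) * pmf Q z = pmf P z * ln (?r z)"
      using cancel[of z] by (simp only: log_def ln_exp) (metis div_by_1 mult.assoc mult.commute)
  qed
  finally show ?thesis .
qed

lemma pmf_noisy_bit:
  assumes "\<bar>\<rho>\<bar> \<le> 1"
  shows "pmf (noisy_bit \<rho> b) c = (if c = b then (1 + \<rho>) / 2 else (1 - \<rho>) / 2)"
proof -
  have "inj (\<lambda>keep. if keep then b else b + 1)"
    by (cases b) (auto simp: inj_def)
  then have *: "pmf (noisy_bit \<rho> b) (if k then b else b + 1) = pmf (bernoulli_pmf ((1 + \<rho>) / 2)) k" for k
    unfolding noisy_bit_def by (rule pmf_map_inj')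
  show ?thesis
  proof (cases "c = b")
    case True
    then show ?thesis using *[of True] assms by simp
  next
    case False
    then have "c = b + 1" by (cases b; cases c) auto
    then show ?thesis using *[of False] False assms by (simp add: field_simps)
  qed
qed

lemma pmf_correlated_pair:
  fixes x y :: "bit ^ 'n"
  assumes "\<bar>\<rho>\<bar> \<le> 1"
  shows "pmf (correlated_pair \<rho>) (x, y) =
    (1 / 2 ^ CARD('n)) * (\<Prod>i\<in>UNIV. if y $ i = x $ i then (1 + \<rho>) / 2 else (1 - \<rho>) / 2)"
proof -
  let ?N = "\<lambda>x :: bit ^ 'n. Pi_pmf UNIV 0 (\<lambda>i. noisy_bit \<rho> (x $ i))"
  have card_bit: "CARD(bit) = 2"
  proof -
    have "(UNIV :: bit set) = {0, 1}" by (auto intro: bit.exhaust)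
    then show ?thesis by (simp only: card_2_iff) auto
  qed
  have inner: "pmf (map_pmf (\<lambda>z. (x', vec_lambda z)) (?N x')) (x, y) =
      (if x' = x then pmf (?N x) (vec_nth y) else 0)" for x'
  proof (cases "x' = x")
    case True
    have "inj (\<lambda>z. (x, vec_lambda z :: bit ^ 'n))"
      by (auto simp: inj_def vec_lambda_inject)
    from pmf_map_inj'[OF this, of "?N x" "vec_nth y"] True show ?thesis
      by (simp add: vec_nth_inverse)
  next
    case False
    then show ?thesis by (auto simp: pmf_eq_0_set_pmf)
  qed
  have "pmf (correlated_pair \<rho>) (x, y) =
      (\<integral>x'. (if x' = x then pmf (?N x) (vec_nth y) else 0) \<partial>pmf_of_set UNIV)"
    unfolding correlated_pair_def pmf_bind[of "pmf_of_set UNIV"]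
    by (simp add: map_pmf_def[symmetric] inner)
  also have "\<dots> = pmf (?N x) (vec_nth y) / CARD(bit ^ 'n)"
    by (subst integral_pmf_of_set) auto
  also have "pmf (?N x) (vec_nth y) = (\<Prod>i\<in>UNIV. pmf (noisy_bit \<rho> (x $ i)) (y $ i))"
    by (subst pmf_Pi') auto
  finally show ?thesis
    using assms by (simp add: pmf_noisy_bit card_bit)
qed

lemma set_pmf_joint_law:
  fixes f g :: "bit ^ 'n \<Rightarrow> real"
  assumes "\<bar>\<rho>\<bar> < 1"
  shows "set_pmf (joint_law f g \<rho>) = range f \<times> range g"
proof -
  have "(x, y) \<in> set_pmf (correlated_pair \<rho>)" for x y :: "bit ^ 'n"
    using assms by (auto simp: set_pmf_iff pmf_correlated_pair)
  then have "set_pmf (correlated_pair \<rho>) = (UNIV :: ((bit ^ 'n) \<times> (bit ^ 'n)) set)"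
    by auto
  then show ?thesis
    by (auto simp: joint_law_def)
qed

end

theory Submission
  imports Defs
begin

text \<open>
  Let $a = E f$ and $c = 1 - a^2$. By Fourier expansion,
  $E f(X) f(Y) = a^2 + c\,\theta(\rho)$ where $c\,\theta(\rho) = \sum_{S \neq \emptyset} \hat f(S)^2 \rho^{|S|}$,
  so $\theta(\rho)$ is a convex combination of the powers $\rho^k$, $1 \le k \le n$, with weights that do
  not depend on $\rho$. The law of $(f(X), f(Y))$ depends only on $a$ and, affinely, on $\theta$. For an
  affine family $(P_\theta)$ one has $D(P_\alpha \| P_\beta) = \int_\beta^\alpha (\alpha - u) I(u)\,du$
  with $I$ the Fisher information, and for $u \ge 0$ the information is largest at $a = 0$. Hence the
  divergence is at most $d(\frac{1+\theta(\rho_0)}{2} \| \frac{1+\theta(\rho_1)}{2})$, and joint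
  convexity of $d$ bounds this by the maximum over $k$.
\<close>

section \<open>Convexity of the divergence\<close>

text \<open>The bound \<open>ln t \<le> t - 1\<close> at \<open>t = (b i / a i) * (A / B)\<close>
  bounds each summand below by an expression linear in \<open>a i\<close> and \<open>b i\<close>.
  After weighted summation the correction is \<open>A - B * (A / B) = 0\<close>.\<close>

lemma log_sum_ineq:
  fixes a b w :: "'i \<Rightarrow> real"
  assumes "finite I" and "\<And>i. i \<in> I \<Longrightarrow> a i > 0" and "\<And>i. i \<in> I \<Longrightarrow> b i > 0"
    and "\<And>i. i \<in> I \<Longrightarrow> w i \<ge> 0"
    and A: "(\<Sum>i\<in>I. w i * a i) > 0" and B: "(\<Sum>i\<in>I. w i * b i) > 0"
  shows "(\<Sum>i\<in>I. w i * a i) * ln ((\<Sum>i\<in>I. w i * a i) / (\<Sum>i\<in>I. w i * b i))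
    \<le> (\<Sum>i\<in>I. w i * (a i * ln (a i / b i)))"
proof -
  define A B where "A = (\<Sum>i\<in>I. w i * a i)" and "B = (\<Sum>i\<in>I. w i * b i)"
  have pos: "A > 0" "B > 0" using A B by (simp_all add: A_def B_def)
  have "w i * (a i * ln (A / B) + a i - b i * (A / B)) \<le> w i * (a i * ln (a i / b i))" if "i \<in> I" for i
  proof (intro mult_left_mono)
    have p: "a i > 0" "b i > 0" using assms that by auto
    have "ln ((b i / a i) * (A / B)) \<le> (b i / a i) * (A / B) - 1"
      using p pos by (intro ln_le_minus_one) auto
    moreover have "ln ((b i / a i) * (A / B)) = ln (A / B) - ln (a i / b i)"
      using p pos by (simp add: ln_mult ln_div)
    ultimately have "a i * (ln (A / B) - ln (a i / b i)) \<le> a i * ((b i / a i) * (A / B) - 1)"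
      using p by (intro mult_left_mono) auto
    also have "\<dots> = b i * (A / B) - a i" using p by (simp add: field_simps)
    finally show "a i * ln (A / B) + a i - b i * (A / B) \<le> a i * ln (a i / b i)"
      by (simp add: algebra_simps)
  qed (use assms that in auto)
  then have "(\<Sum>i\<in>I. w i * (a i * ln (A / B) + a i - b i * (A / B)))
      \<le> (\<Sum>i\<in>I. w i * (a i * ln (a i / b i)))"
    by (rule sum_mono)
  also have "(\<Sum>i\<in>I. w i * (a i * ln (A / B) + a i - b i * (A / B))) =
      A * ln (A / B) + A - B * (A / B)"
    unfolding A_def B_def sum_distrib_right sum.distrib[symmetric] sum_subtractf[symmetric]
    by (intro sum.cong) (auto simp: algebra_simps)
  finally show ?thesis using pos by (simp add: A_def B_def)
qed

text \<open>Joint convexity of the binary divergence: the log-sum inequality is applied once to the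
  \<open>p i\<close> and once to the \<open>1 - p i\<close>. Since the weights sum to 1, taking
  complements commutes with averaging.\<close>

lemma binary_KL_div_jensen:
  fixes p q w :: "'i \<Rightarrow> real"
  assumes "finite I" and "\<And>i. i \<in> I \<Longrightarrow> w i \<ge> 0" and w: "(\<Sum>i\<in>I. w i) = 1"
    and p: "\<And>i. i \<in> I \<Longrightarrow> p i \<in> {0<..<1}" and q: "\<And>i. i \<in> I \<Longrightarrow> q i \<in> {0<..<1}"
  shows "binary_KL_div (\<Sum>i\<in>I. w i * p i) (\<Sum>i\<in>I. w i * q i)
    \<le> (\<Sum>i\<in>I. w i * binary_KL_div (p i) (q i))"
proof -
  have pos: "(\<Sum>i\<in>I. w i * r i) > 0" if "\<And>i. i \<in> I \<Longrightarrow> r i > 0" for r :: "'i \<Rightarrow> real"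
  proof -
    obtain j where "j \<in> I" "w j \<noteq> 0" using w by (metis sum.neutral zero_neq_one)
    then show ?thesis
      using assms(1,2) that by (intro sum_pos2[of I j]) (auto simp: less_le)
  qed
  have compl: "(\<Sum>i\<in>I. w i * (1 - r i)) = 1 - (\<Sum>i\<in>I. w i * r i)" for r
    using w by (simp add: algebra_simps sum_subtractf)
  have "(\<Sum>i\<in>I. w i * p i) * ln ((\<Sum>i\<in>I. w i * p i) / (\<Sum>i\<in>I. w i * q i))
      + (\<Sum>i\<in>I. w i * (1 - p i)) * ln ((\<Sum>i\<in>I. w i * (1 - p i)) / (\<Sum>i\<in>I. w i * (1 - q i)))
    \<le> (\<Sum>i\<in>I. w i * (p i * ln (p i / q i))) + (\<Sum>i\<in>I. w i * ((1 - p i) * ln ((1 - p i) / (1 - q i))))"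
    using assms by (intro add_mono log_sum_ineq pos) auto
  then show ?thesis
    by (simp only: binary_KL_div_def compl distrib_left sum.distrib)
qed

text \<open>The log-sum inequality on a two-point set: both totals are 1, so its left-hand side is
  \<open>1 * ln 1 = 0\<close>.\<close>

lemma binary_KL_div_nonneg:
  assumes "p \<in> {0<..<1}" and "q \<in> {0<..<1}"
  shows "binary_KL_div p q \<ge> 0"
  using log_sum_ineq[of UNIV "\<lambda>b. if b then p else 1 - p" "\<lambda>b. if b then q else 1 - q" "\<lambda>_. 1"] assms
  by (simp add: UNIV_bool binary_KL_div_def add.commute if_bool_eq_conj)

section \<open>Comparison with the unbiased case by differentiation\<close>

text \<open>Cell probabilities are affine in the correlation, so each divergence term has this shape
  as a function of the second argument. The logarithm of the quotient is split only near
  \<open>u\<close>, where the denominator stays positive.\<close>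

lemma has_real_derivative_mult_ln_div:
  fixes A k m u :: real
  assumes "A > 0" and "k + m * u > 0"
  shows "((\<lambda>u. A * ln (A / (k + m * u))) has_real_derivative - A * m / (k + m * u)) (at u)"
proof -
  have "((\<lambda>u. A * ln A - A * ln (k + m * u)) has_real_derivative - A * m / (k + m * u)) (at u)"
    using assms by (auto intro!: derivative_eq_intros)
  moreover have "\<forall>\<^sub>F v in nhds u. k + m * v > 0"
    using assms(2) by (intro order_tendstoD(1)[of _ "k + m * u"] tendsto_intros filterlim_ident)
  then have "\<forall>\<^sub>F v in nhds u. A * ln A - A * ln (k + m * v) = A * ln (A / (k + m * v))"
    by eventually_elim (use assms in \<open>simp add: ln_div algebra_simps\<close>)
  ultimately show ?thesis
    by (subst (asm) DERIV_cong_ev[OF refl _ refl]) auto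
qed

text \<open>The derivative changes sign only at \<alpha>, so \<open>G\<close> decreases up to
  \<alpha> and increases after it; its minimum on the interval is
  \<open>G \<alpha> = 0\<close>.\<close>

lemma DERIV_sign_imp_nonneg:
  fixes G :: "real \<Rightarrow> real"
  assumes "\<And>u. u \<in> {0..<1} \<Longrightarrow> (G has_real_derivative (u - \<alpha>) * J u) (at u)"
    and "\<And>u. u \<in> {0..<1} \<Longrightarrow> J u \<ge> 0"
    and "G \<alpha> = 0" and "\<alpha> \<in> {0..<1}" and "\<beta> \<in> {0..<1}"
  shows "G \<beta> \<ge> 0"
proof (cases "\<alpha> \<le> \<beta>")
  case True
  have "\<exists>y. (G has_real_derivative y) (at u) \<and> y \<ge> 0" if "\<alpha> \<le> u" "u \<le> \<beta>" for u
    using assms that by (intro exI[of _ "(u - \<alpha>) * J u"]) auto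
  with True have "G \<alpha> \<le> G \<beta>" by (rule DERIV_nonneg_imp_nondecreasing)
  then show ?thesis using assms by simp
next
  case False
  have "\<exists>y. (G has_real_derivative y) (at u) \<and> y \<le> 0" if "\<beta> \<le> u" "u \<le> \<alpha>" for u
    using assms that by (intro exI[of _ "(u - \<alpha>) * J u"]) (auto intro!: mult_nonpos_nonneg)
  with False have "G \<alpha> \<le> G \<beta>" by (intro DERIV_nonpos_imp_nonincreasing[of \<beta> \<alpha>]) auto
  then show ?thesis using assms by simp
qed

text \<open>
  The left-hand side is the divergence of the laws on $\{\pm1\}^2$ whose marginals both have mean
  \<open>a\<close> and whose correlation coefficients are \<open>\<alpha>\<close> and \<open>\<beta>\<close>. Below, \<open>G\<close> is the right-hand side
  minus the left-hand side as a function of \<open>\<beta>\<close>, and \<open>J\<close> is the difference of the Fisher informations.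
\<close>

lemma KL_equal_marginals_le_unbiased:
  fixes a \<alpha> \<beta> :: real
  defines "c \<equiv> 1 - a\<^sup>2"
  assumes a: "-1 < a" "a < 1" and \<alpha>: "\<alpha> \<in> {0..<1}" and \<beta>: "\<beta> \<in> {0..<1}"
  shows "c / 2 * ((1 - \<alpha>) * ln ((1 - \<alpha>) / (1 - \<beta>)))
      + (1 + a) / 4 * ((1 + a + (1 - a) * \<alpha>) * ln ((1 + a + (1 - a) * \<alpha>) / (1 + a + (1 - a) * \<beta>)))
      + (1 - a) / 4 * ((1 - a + (1 + a) * \<alpha>) * ln ((1 - a + (1 + a) * \<alpha>) / (1 - a + (1 + a) * \<beta>)))
    \<le> binary_KL_div ((1 + \<alpha>) / 2) ((1 + \<beta>) / 2)"
proof -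
  have c: "0 < c" "c \<le> 1" using a by (auto simp: c_def abs_square_less_1)
  \<comment> \<open>The forms \<open>1 + (- 1) * u\<close> here and \<open>1 + 1 * u\<close> in
    \<open>G\<close> match the pattern \<open>k + m * u\<close> of the derivative rule.\<close>
  define F where "F u = c / 2 * ((1 - \<alpha>) * ln ((1 - \<alpha>) / (1 + (- 1) * u)))
      + (1 + a) / 4 * ((1 + a + (1 - a) * \<alpha>) * ln ((1 + a + (1 - a) * \<alpha>) / (1 + a + (1 - a) * u)))
      + (1 - a) / 4 * ((1 - a + (1 + a) * \<alpha>) * ln ((1 - a + (1 + a) * \<alpha>) / (1 - a + (1 + a) * u)))"
    for u
  define G where "G u = 1 / 2 * ((1 - \<alpha>) * ln ((1 - \<alpha>) / (1 + (- 1) * u)))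
      + 1 / 2 * ((1 + \<alpha>) * ln ((1 + \<alpha>) / (1 + 1 * u))) - F u" for u
  define J where "J u = 1 / (1 - u\<^sup>2) - c * (1 + u) / ((1 - u) * (c * (1 - u)\<^sup>2 + 4 * u))" for u
  have "G \<beta> \<ge> 0"
  proof (rule DERIV_sign_imp_nonneg[OF _ _ _ \<alpha> \<beta>])
    show "G \<alpha> = 0" using a \<alpha> by (simp add: G_def F_def)
  next
    fix u :: real assume u: "u \<in> {0..<1}"
    have Q: "(1 + a + (1 - a) * x) > 0" "(1 - a + (1 + a) * x) > 0" if "x \<ge> 0" for x
      using a that by (simp_all add: add_pos_nonneg[OF _ mult_nonneg_nonneg])
    have QQ: "(1 + a + (1 - a) * u) * (1 - a + (1 + a) * u) = c * (1 - u)\<^sup>2 + 4 * u"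
      by (simp add: c_def algebra_simps power2_eq_square)
    have QQpos: "c * (1 - u)\<^sup>2 + 4 * u > 0"
      using Q[of u] u by (subst QQ[symmetric]) auto
    have "(G has_real_derivative
        1 / 2 * (- (1 - \<alpha>) * (- 1) / (1 + (- 1) * u)) + 1 / 2 * (- (1 + \<alpha>) * 1 / (1 + 1 * u))
        - (c / 2 * (- (1 - \<alpha>) * (- 1) / (1 + (- 1) * u))
         + (1 + a) / 4 * (- (1 + a + (1 - a) * \<alpha>) * (1 - a) / (1 + a + (1 - a) * u))
         + (1 - a) / 4 * (- (1 - a + (1 + a) * \<alpha>) * (1 + a) / (1 - a + (1 + a) * u)))) (at u)"
      unfolding G_def F_def using u \<alpha> Q[of u] Q[of \<alpha>]
      by (intro DERIV_add DERIV_diff DERIV_cmult has_real_derivative_mult_ln_div) auto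
    also have "1 / 2 * (- (1 - \<alpha>) * (- 1) / (1 + (- 1) * u)) + 1 / 2 * (- (1 + \<alpha>) * 1 / (1 + 1 * u))
       = (u - \<alpha>) * (1 / (1 - u\<^sup>2))"
    proof -
      have "1 - u\<^sup>2 = (1 - u) * (1 + u)" by (simp add: algebra_simps power2_eq_square)
      then show ?thesis using u by (simp add: divide_simps) (simp add: algebra_simps power2_eq_square)
    qed
    also have "c / 2 * (- (1 - \<alpha>) * (- 1) / (1 + (- 1) * u))
         + (1 + a) / 4 * (- (1 + a + (1 - a) * \<alpha>) * (1 - a) / (1 + a + (1 - a) * u))
         + (1 - a) / 4 * (- (1 - a + (1 + a) * \<alpha>) * (1 + a) / (1 - a + (1 + a) * u))
       = (u - \<alpha>) * (c * (1 + u) / ((1 - u) * (c * (1 - u)\<^sup>2 + 4 * u)))"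
    proof -
      define q r v where "q = 1 + a + (1 - a) * u" and "r = 1 - a + (1 + a) * u" and "v = 1 - u"
      have pos: "q > 0" "r > 0" "v > 0" using Q[of u] u by (auto simp: q_def r_def v_def)
      \<comment> \<open>Expanding the numerators around \<open>u\<close> isolates the constants
        \<open>c / 2 - c / 4 - c / 4\<close>, which cancel; everything left carries the factor
        \<open>u - \<alpha>\<close>.\<close>
      have shift: "1 + a + (1 - a) * \<alpha> = q - (1 - a) * (u - \<alpha>)"
        "1 - a + (1 + a) * \<alpha> = r - (1 + a) * (u - \<alpha>)" "1 - \<alpha> = v + (u - \<alpha>)"
        by (simp_all add: q_def r_def v_def algebra_simps)
      have "c / 2 * (- (1 - \<alpha>) * (- 1) / v) + (1 + a) / 4 * (- (1 + a + (1 - a) * \<alpha>) * (1 - a) / q)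
         + (1 - a) / 4 * (- (1 - a + (1 + a) * \<alpha>) * (1 + a) / r)
         = c / 2 * (1 + (u - \<alpha>) / v) - c / 4 * (1 - (1 - a) * (u - \<alpha>) / q)
           - c / 4 * (1 - (1 + a) * (u - \<alpha>) / r)"
        unfolding shift using pos by (simp add: c_def field_simps power2_eq_square)
      also have "\<dots> = c * (u - \<alpha>) * ((2 * (q * r) + v * ((1 - a) * r + (1 + a) * q)) / (4 * (v * (q * r))))"
        using pos by (simp add: field_simps)
      also have "2 * (q * r) + v * ((1 - a) * r + (1 + a) * q) = 4 * (1 + u)"
        by (simp add: q_def r_def v_def algebra_simps)
      also have "c * (u - \<alpha>) * (4 * (1 + u) / (4 * (v * (q * r)))) = (u - \<alpha>) * (c * (1 + u) / (v * (q * r)))"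
        by (subst mult_divide_mult_cancel_left) (simp_all add: mult_ac)
      finally show ?thesis by (simp add: q_def r_def v_def QQ)
    qed
    finally show "(G has_real_derivative (u - \<alpha>) * J u) (at u)"
      by (simp add: J_def algebra_simps)
    \<comment> \<open>As \<open>(1 + u)\<^sup>2 = (1 - u)\<^sup>2 + 4 * u\<close>, this amounts to
      \<open>c * (4 * u) \<le> 4 * u\<close>, where \<open>c \<le> 1\<close> and
      \<open>u \<ge> 0\<close> enter.\<close>
    have "c * (1 + u)\<^sup>2 \<le> c * (1 - u)\<^sup>2 + 4 * u"
      using c u mult_right_mono[of c 1 "4 * u"] by (simp add: algebra_simps power2_eq_square)
    then have "c * (1 + u) / ((1 - u) * (c * (1 - u)\<^sup>2 + 4 * u)) \<le> 1 / ((1 - u) * (1 + u))"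
      using u QQpos by (simp add: divide_simps) (simp add: algebra_simps power2_eq_square)
    then show "J u \<ge> 0" by (simp add: J_def algebra_simps power2_eq_square)
  qed
  moreover have "binary_KL_div ((1 + \<alpha>) / 2) ((1 + \<beta>) / 2) =
     1 / 2 * ((1 - \<alpha>) * ln ((1 - \<alpha>) / (1 + (- 1) * \<beta>)))
      + 1 / 2 * ((1 + \<alpha>) * ln ((1 + \<alpha>) / (1 + 1 * \<beta>)))"
  proof -
    have half: "1 - (1 + x) / 2 = (1 - x) / 2" for x :: real by (simp add: field_simps)
    have ratio: "x / 2 / (y / 2) = x / y" for x y :: real by simp
    show ?thesis by (simp only: binary_KL_div_def half ratio) simp
  qed
  ultimately show ?thesis by (simp add: G_def F_def)
qed

section \<open>Fourier analysis of correlated pairs\<close>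

definition character :: "'n set \<Rightarrow> bit ^ 'n \<Rightarrow> real" where
  "character S x = (\<Prod>i\<in>S. if x $ i = 0 then 1 else - 1)"

text \<open>The normalization is that of the uniform law, so \<open>fourier f {}\<close> is the mean
  of \<open>f\<close>.\<close>

definition fourier :: "(bit ^ 'n \<Rightarrow> real) \<Rightarrow> 'n set \<Rightarrow> real" where
  "fourier f S = (\<Sum>x\<in>UNIV. f x * character S x) / 2 ^ CARD('n)"

text \<open>Each coordinate contributes half of 1 plus \<rho> times the product of the two signs.
  Expanding the product over coordinates gives one term per subset \<open>S\<close>. One power of 2
  comes from these halves, the other from the uniform law of the first vector.\<close>

lemma pmf_correlated_pair_eq_characters:
  fixes x y :: "bit ^ 'n"
  assumes "\<bar>\<rho>\<bar> \<le> 1"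
  shows "pmf (correlated_pair \<rho>) (x, y) =
    (\<Sum>S\<in>UNIV. \<rho> ^ card S * character S x * character S y) / (2 ^ CARD('n) * 2 ^ CARD('n))"
proof -
  let ?s = "\<lambda>z i. if z $ i = (0 :: bit) then 1 else - 1 :: real"
  have "(if y $ i = x $ i then (1 + \<rho>) / 2 else (1 - \<rho>) / 2) = (\<rho> * ?s x i * ?s y i + 1) / 2" for i
    by (cases "x $ i"; cases "y $ i") auto
  then have "(\<Prod>i\<in>UNIV. if y $ i = x $ i then (1 + \<rho>) / 2 else (1 - \<rho>) / 2)
      = (\<Prod>i\<in>UNIV. \<rho> * ?s x i * ?s y i + 1) / 2 ^ CARD('n)"
    by (simp only: prod_dividef prod_constant)
  also have "(\<Prod>i\<in>UNIV. \<rho> * ?s x i * ?s y i + 1) =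
      (\<Sum>S\<in>UNIV. \<rho> ^ card S * character S x * character S y)"
    by (subst prod_add) (simp_all only: character_def prod.distrib prod_constant Pow_UNIV
        power_one mult_1_right finite)
  finally show ?thesis using assms by (simp add: pmf_correlated_pair)
qed

text \<open>Characters diagonalize the correlation kernel: once the sum over \<open>S\<close> is
  outermost, the sums over \<open>x\<close> and \<open>y\<close> separate, each giving
  \<open>fourier f S\<close>.\<close>

lemma expectation_correlated_pair_eq_fourier:
  fixes f :: "bit ^ 'n \<Rightarrow> real"
  assumes "\<bar>\<rho>\<bar> \<le> 1"
  shows "measure_pmf.expectation (correlated_pair \<rho>) (\<lambda>z. f (fst z) * f (snd z))
    = (\<Sum>S\<in>UNIV. (fourier f S)\<^sup>2 * \<rho> ^ card S)"
proof -
  let ?N = "2 ^ CARD('n) :: real"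
  have "measure_pmf.expectation (correlated_pair \<rho>) (\<lambda>z. f (fst z) * f (snd z)) =
      (\<Sum>x\<in>UNIV. \<Sum>y\<in>UNIV. f x * f y * pmf (correlated_pair \<rho>) (x, y))"
    by (subst integral_measure_pmf_real[of UNIV])
      (auto simp: sum.cartesian_product UNIV_Times_UNIV[symmetric] case_prod_beta simp del: UNIV_Times_UNIV)
  also have "\<dots> = (\<Sum>x\<in>UNIV. \<Sum>y\<in>UNIV. \<Sum>S\<in>UNIV.
      \<rho> ^ card S * (f x * character S x / ?N) * (f y * character S y / ?N))"
    using assms by (simp add: pmf_correlated_pair_eq_characters sum_distrib_left sum_divide_distrib mult_ac)
  also have "\<dots> = (\<Sum>x\<in>UNIV. \<Sum>S\<in>UNIV. \<Sum>y\<in>UNIV.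
      \<rho> ^ card S * (f x * character S x / ?N) * (f y * character S y / ?N))"
    by (intro sum.cong refl sum.swap)
  also have "\<dots> = (\<Sum>S\<in>UNIV. \<Sum>x\<in>UNIV. \<Sum>y\<in>UNIV.
      \<rho> ^ card S * (f x * character S x / ?N) * (f y * character S y / ?N))"
    by (rule sum.swap)
  also have "\<dots> = (\<Sum>S\<in>UNIV. (fourier f S)\<^sup>2 * \<rho> ^ card S)"
    unfolding fourier_def power2_eq_square sum_divide_distrib
    by (simp only: sum_product sum_distrib_left sum_distrib_right mult_ac)
  finally show ?thesis .
qed

lemma map_fst_correlated_pair: "map_pmf fst (correlated_pair \<rho>) = pmf_of_set UNIV"
  by (simp add: correlated_pair_def map_bind_pmf map_pmf_def[symmetric] map_pmf_comp bind_return_pmf')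

text \<open>The mass depends only on the coordinates where the two vectors agree. This symmetry
  transfers the mean from the first component to the second.\<close>

lemma map_swap_correlated_pair:
  assumes "\<bar>\<rho>\<bar> \<le> 1"
  shows "map_pmf prod.swap (correlated_pair \<rho>) = correlated_pair \<rho>"
proof (rule pmf_eqI)
  fix z :: "(bit ^ 'n) \<times> (bit ^ 'n)"
  have "pmf (map_pmf prod.swap (correlated_pair \<rho>)) (prod.swap (prod.swap z)) = pmf (correlated_pair \<rho>) (prod.swap z)"
    by (rule pmf_map_inj') simp
  also have "\<dots> = pmf (correlated_pair \<rho>) z"
    using assms by (cases z) (auto simp: pmf_correlated_pair intro!: prod.cong)
  finally show "pmf (map_pmf prod.swap (correlated_pair \<rho>)) z = pmf (correlated_pair \<rho>) z" by simp
qed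

lemma correlated_pair_1: "correlated_pair 1 = map_pmf (\<lambda>x. (x, x)) (pmf_of_set UNIV)"
proof -
  have "noisy_bit 1 b = return_pmf b" for b
    by (rule pmf_eqI) (simp add: pmf_noisy_bit)
  then show ?thesis
    by (simp add: correlated_pair_def Pi_pmf_return_pmf bind_return_pmf map_pmf_def)
qed

lemma card_bit: "CARD(bit) = 2"
proof -
  have "(UNIV :: bit set) = {0, 1}" by (auto intro: bit.exhaust)
  then show ?thesis by (simp only: card_2_iff) auto
qed

lemma expectation_fst_correlated_pair:
  fixes f :: "bit ^ 'n \<Rightarrow> real"
  shows "measure_pmf.expectation (correlated_pair \<rho>) (\<lambda>z. f (fst z)) = fourier f {}"
proof -
  have "measure_pmf.expectation (correlated_pair \<rho>) (\<lambda>z. f (fst z)) =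
     measure_pmf.expectation (map_pmf fst (correlated_pair \<rho>)) f"
    by simp
  also have "\<dots> = fourier f {}"
    by (simp only: map_fst_correlated_pair)
      (simp add: integral_pmf_of_set fourier_def character_def card_bit)
  finally show ?thesis .
qed

lemma expectation_snd_correlated_pair:
  fixes f :: "bit ^ 'n \<Rightarrow> real"
  assumes "\<bar>\<rho>\<bar> \<le> 1"
  shows "measure_pmf.expectation (correlated_pair \<rho>) (\<lambda>z. f (snd z)) = fourier f {}"
proof -
  have "measure_pmf.expectation (correlated_pair \<rho>) (\<lambda>z. f (snd z)) =
     measure_pmf.expectation (map_pmf prod.swap (correlated_pair \<rho>)) (\<lambda>z. f (fst z))"
    by simp
  then show ?thesis
    by (simp only: map_swap_correlated_pair[OF assms] expectation_fst_correlated_pair)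
qed

text \<open>At correlation 1 the two vectors coincide and all powers of the correlation equal
  1.\<close>

lemma parseval:
  fixes f :: "bit ^ 'n \<Rightarrow> real"
  shows "(\<Sum>S\<in>UNIV. (fourier f S)\<^sup>2) = (\<Sum>x\<in>UNIV. (f x)\<^sup>2) / 2 ^ CARD('n)"
  using expectation_correlated_pair_eq_fourier[of 1 f]
  by (simp add: correlated_pair_1 integral_pmf_of_set card_bit power2_eq_square)

text \<open>For sign-valued \<open>f\<close>, the indicator of the cell \<open>(u, v)\<close> is
  \<open>(1 + u * f x) * (1 + v * f y) / 4\<close>, whose expectation involves only the mean and the
  correlation.\<close>

lemma pmf_joint_law_pm1:
  fixes f :: "bit ^ 'n \<Rightarrow> real"
  assumes \<rho>: "\<bar>\<rho>\<bar> \<le> 1" and f: "\<And>x. f x \<in> {-1, 1}" and uv: "u \<in> {-1, 1}" "v \<in> {-1, 1}"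
  shows "pmf (joint_law f f \<rho>) (u, v) =
    (1 + (u + v) * fourier f {} + u * v * (\<Sum>S\<in>UNIV. (fourier f S)\<^sup>2 * \<rho> ^ card S)) / 4"
proof -
  let ?M = "correlated_pair \<rho> :: ((bit ^ 'n) \<times> (bit ^ 'n)) pmf"
  have int: "integrable ?M h" for h :: "_ \<Rightarrow> real"
    by (intro integrable_measure_pmf_finite) simp
  have "pmf (joint_law f f \<rho>) (u, v) =
      measure_pmf.expectation ?M (indicator ((\<lambda>(x, y). (f x, f y)) -` {(u, v)}))"
    unfolding joint_law_def pmf_map by simp
  also have "\<dots> = measure_pmf.expectation ?M (\<lambda>z.
      1 / 4 + u / 4 * f (fst z) + v / 4 * f (snd z) + u * v / 4 * (f (fst z) * f (snd z)))"
  proof (intro Bochner_Integration.integral_cong refl)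
    fix z
    show "indicator ((\<lambda>(x, y). (f x, f y)) -` {(u, v)}) z =
      1 / 4 + u / 4 * f (fst z) + v / 4 * f (snd z) + u * v / 4 * (f (fst z) * f (snd z))"
      using f[of "fst z"] f[of "snd z"] uv by (cases z) (auto simp: indicator_def)
  qed
  also have "\<dots> = 1 / 4 + u / 4 * fourier f {} + v / 4 * fourier f {}
      + u * v / 4 * (\<Sum>S\<in>UNIV. (fourier f S)\<^sup>2 * \<rho> ^ card S)"
    using \<rho> by (simp only: int Bochner_Integration.integral_add integral_mult_right_zero
        expectation_fst_correlated_pair expectation_snd_correlated_pair
        expectation_correlated_pair_eq_fourier integral_const Bochner_Integration.integrable_add)
      simp
  finally show ?thesis by (simp add: field_simps)
qed


section \<open>Divergence of the joint laws\<close>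

lemma KL_div_map_pmf_inj:
  assumes h: "inj h" and fin: "finite (set_pmf P)" and ac: "set_pmf P \<subseteq> set_pmf Q"
  shows "KL_div (map_pmf h P) (map_pmf h Q) = KL_div P Q"
proof -
  have "KL_div (map_pmf h P) (map_pmf h Q) =
      (\<Sum>z\<in>h ` set_pmf P. pmf (map_pmf h P) z * ln (pmf (map_pmf h P) z / pmf (map_pmf h Q) z))"
    using fin ac by (intro KL_div_eq_sum) auto
  also have "\<dots> = (\<Sum>z\<in>set_pmf P. pmf P z * ln (pmf P z / pmf Q z))"
    using inj_on_subset[OF h] by (subst sum.reindex) (auto simp: pmf_map_inj'[OF h])
  also have "\<dots> = KL_div P Q"
    using fin ac by (intro KL_div_eq_sum[symmetric]) auto
  finally show ?thesis .
qed

text \<open>With an arbitrary bound \<open>B\<close> in place of the maximum, the final averaging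
  over \<open>S\<close> is a termwise estimate.\<close>

lemma KL_div_joint_law_le:
  fixes f :: "bit ^ 'n \<Rightarrow> real"
  assumes \<rho>0: "\<rho>0 \<in> {0..<1}" and \<rho>1: "\<rho>1 \<in> {0..<1}" and f: "\<And>x. f x \<in> {-1, 1}"
    and B: "\<And>k. k \<in> {1..CARD('n)} \<Longrightarrow> binary_KL_div ((1 + \<rho>0 ^ k) / 2) ((1 + \<rho>1 ^ k) / 2) \<le> B"
  shows "KL_div (joint_law f f \<rho>0) (joint_law f f \<rho>1) \<le> B"
proof -
  define a where "a = fourier f {}"
  define c where "c = 1 - a\<^sup>2"
  define W where "W S = (fourier f S)\<^sup>2" for S
  define I where "I = (UNIV :: 'n set set) - {{}}"
  define s where "s \<rho> = (\<Sum>S\<in>UNIV. W S * \<rho> ^ card S)" for \<rho>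
  have W: "W S \<ge> 0" for S by (simp add: W_def)
  have s_eq: "s \<rho> = a\<^sup>2 + (\<Sum>S\<in>I. W S * \<rho> ^ card S)" for \<rho>
    by (simp add: s_def I_def sum.remove[of UNIV "{}"] W_def a_def)
  \<comment> \<open>Parseval fixes the total Fourier weight at 1, so the nonempty sets carry weight
    \<open>c\<close>.\<close>
  have "(f x)\<^sup>2 = 1" for x using f[of x] by auto
  then have "s 1 = 1"
    using parseval[of f] by (simp add: s_def W_def card_bit)
  then have sum_W: "(\<Sum>S\<in>I. W S) = c" by (simp add: s_eq c_def)
  have card_I: "card S \<in> {1..CARD('n)}" if "S \<in> I" for S
    using that by (auto simp: I_def Suc_le_eq card_gt_0_iff intro: card_mono)
  have half: "(1 + \<rho> ^ k) / 2 \<in> {0<..<1}" if "\<rho> \<in> {0..<1}" "k \<in> {1..CARD('n)}" for \<rho> :: real and k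
    using that by (auto simp: power_less_one_iff add_pos_nonneg)
  \<comment> \<open>The two cells with \<open>u \<noteq> v\<close> have equal mass
    \<open>(1 - s \<rho>) / 4\<close> and are merged into the first term.\<close>
  have KL: "KL_div (joint_law f f \<rho>0) (joint_law f f \<rho>1) =
      (1 - s \<rho>0) / 2 * ln ((1 - s \<rho>0) / (1 - s \<rho>1))
      + (1 + 2 * a + s \<rho>0) / 4 * ln ((1 + 2 * a + s \<rho>0) / (1 + 2 * a + s \<rho>1))
      + (1 - 2 * a + s \<rho>0) / 4 * ln ((1 - 2 * a + s \<rho>0) / (1 - 2 * a + s \<rho>1))"
  proof -
    have "KL_div (joint_law f f \<rho>0) (joint_law f f \<rho>1) = (\<Sum>z\<in>{-1, 1} \<times> {-1, 1}.
        pmf (joint_law f f \<rho>0) z * ln (pmf (joint_law f f \<rho>0) z / pmf (joint_law f f \<rho>1) z))"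
      using \<rho>0 \<rho>1 f by (intro KL_div_eq_sum) (auto simp: set_pmf_joint_law)
    also have "\<dots> = (\<Sum>u\<in>{-1, 1}. \<Sum>v\<in>{-1, 1}. (1 + (u + v) * a + u * v * s \<rho>0) / 4 *
        ln ((1 + (u + v) * a + u * v * s \<rho>0) / (1 + (u + v) * a + u * v * s \<rho>1)))"
    proof -
      have law: "pmf (joint_law f f \<rho>) (u, v) = (1 + (u + v) * a + u * v * s \<rho>) / 4"
        if "\<rho> \<in> {0..<1}" "u \<in> {-1, 1}" "v \<in> {-1, 1}" for \<rho> u v
        using that f by (subst pmf_joint_law_pm1) (auto simp: a_def s_def W_def)
      have ratio: "x / 4 / (y / 4) = x / y" for x y :: real by simp
      show ?thesis
        unfolding sum.cartesian_product'
        by (intro sum.cong refl) (simp only: law[OF \<rho>0] law[OF \<rho>1] ratio)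
    qed
    also have "\<dots> = (1 - s \<rho>0) / 2 * ln ((1 - s \<rho>0) / (1 - s \<rho>1))
      + (1 + 2 * a + s \<rho>0) / 4 * ln ((1 + 2 * a + s \<rho>0) / (1 + 2 * a + s \<rho>1))
      + (1 - 2 * a + s \<rho>0) / 4 * ln ((1 - 2 * a + s \<rho>0) / (1 - 2 * a + s \<rho>1))"
      by (simp add: field_simps)
    finally show ?thesis .
  qed
  show ?thesis
  proof (cases "c = 0")
    \<comment> \<open>No weight lies on nonempty sets, so the divergence vanishes. It remains to see
      \<open>B \<ge> 0\<close>, for which \<open>k = 1\<close> serves.\<close>
    case True
    then have "W S = 0" if "S \<in> I" for S
      using sum_nonneg_eq_0_iff[of I W] sum_W W that by (simp add: I_def)
    then have "s \<rho>0 = s \<rho>1" by (simp add: s_eq)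
    then have "KL_div (joint_law f f \<rho>0) (joint_law f f \<rho>1) = 0"
      by (simp add: KL)
    also have "0 \<le> binary_KL_div ((1 + \<rho>0 ^ 1) / 2) ((1 + \<rho>1 ^ 1) / 2)"
      using \<rho>0 \<rho>1 by (intro binary_KL_div_nonneg half) auto
    also have "\<dots> \<le> B" by (intro B) auto
    finally show ?thesis .
  next
    case False
    then have c: "c > 0" using sum_W W by (metis less_le sum_nonneg)
    then have "a\<^sup>2 < 1" by (simp add: c_def)
    then have a: "-1 < a" "a < 1" by (auto simp: abs_square_less_1)
    define w where "w S = W S / c" for S
    have w: "w S \<ge> 0" for S using W c by (simp add: w_def)
    have sum_w: "(\<Sum>S\<in>I. w S) = 1" using sum_W c by (simp add: w_def flip: sum_divide_distrib)
    define \<theta> where "\<theta> \<rho> = (\<Sum>S\<in>I. w S * \<rho> ^ card S)" for \<rho>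
    have s_\<theta>: "s \<rho> = a\<^sup>2 + c * \<theta> \<rho>" for \<rho>
      using c by (simp add: s_eq \<theta>_def w_def sum_distrib_left)
    \<comment> \<open>Every \<open>S\<close> in \<open>I\<close> is nonempty, so
      \<open>\<rho> ^ card S \<le> \<rho>\<close> and the average stays at most \<rho>.\<close>
    have \<theta>: "\<theta> \<rho> \<in> {0..<1}" if \<rho>: "\<rho> \<in> {0..<1}" for \<rho>
    proof -
      have "\<theta> \<rho> \<le> (\<Sum>S\<in>I. w S * \<rho>)"
        unfolding \<theta>_def using \<rho> w card_I
        by (intro sum_mono mult_left_mono) (auto simp: power_decreasing[of 1 _ \<rho>, simplified])
      also have "\<dots> = \<rho>" using sum_w by (simp flip: sum_distrib_right)
      finally show ?thesis using \<rho> w by (auto simp: \<theta>_def intro!: sum_nonneg)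
    qed
    have half_\<theta>: "(1 + \<theta> \<rho>) / 2 = (\<Sum>S\<in>I. w S * ((1 + \<rho> ^ card S) / 2))" for \<rho>
      using sum_w by (simp add: \<theta>_def algebra_simps sum.distrib add_divide_distrib flip: sum_divide_distrib)
    \<comment> \<open>The prefactors \<open>c\<close>, \<open>1 + a\<close> and \<open>1 - a\<close>
      are independent of \<rho>, so they cancel inside the logarithms.\<close>
    have cell: "1 - s \<rho> = c * (1 - \<theta> \<rho>)"
      "1 + 2 * a + s \<rho> = (1 + a) * (1 + a + (1 - a) * \<theta> \<rho>)"
      "1 - 2 * a + s \<rho> = (1 - a) * (1 - a + (1 + a) * \<theta> \<rho>)" for \<rho>
      by (simp_all add: s_\<theta> c_def algebra_simps power2_eq_square)
    have "KL_div (joint_law f f \<rho>0) (joint_law f f \<rho>1) \<le> binary_KL_div ((1 + \<theta> \<rho>0) / 2) ((1 + \<theta> \<rho>1) / 2)"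
      using KL_equal_marginals_le_unbiased[OF a \<theta>[OF \<rho>0] \<theta>[OF \<rho>1]] a c
      by (simp add: KL cell flip: c_def)
    also have "\<dots> \<le> (\<Sum>S\<in>I. w S * binary_KL_div ((1 + \<rho>0 ^ card S) / 2) ((1 + \<rho>1 ^ card S) / 2))"
      unfolding half_\<theta> using w sum_w half card_I \<rho>0 \<rho>1
      by (intro binary_KL_div_jensen) (simp_all add: I_def)
    also have "\<dots> \<le> (\<Sum>S\<in>I. w S * B)"
      using w card_I by (intro sum_mono mult_left_mono B) auto
    also have "\<dots> = B" using sum_w by (simp flip: sum_distrib_right)
    finally show ?thesis .
  qed
qed

theorem theorem2:
  fixes f :: "bit ^ 'n \<Rightarrow> real" and \<rho>0 \<rho>1 :: real
  assumes "\<rho>0 \<in> {0..<1}" and "\<rho>1 \<in> {0..<1}"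
    and "\<And>x. f x \<in> {-1, 1}"
  shows "KL_div (joint_law f f \<rho>0) (joint_law f f \<rho>1)
           \<le> (MAX k\<in>{1..CARD('n)}. binary_KL_div ((1 + \<rho>0 ^ k) / 2) ((1 + \<rho>1 ^ k) / 2))
       \<and> KL_div (joint_law f (\<lambda>x. - f x) \<rho>0) (joint_law f (\<lambda>x. - f x) \<rho>1)
           \<le> (MAX k\<in>{1..CARD('n)}. binary_KL_div ((1 + \<rho>0 ^ k) / 2) ((1 + \<rho>1 ^ k) / 2))"
proof -
  \<comment> \<open>Negating the second coordinate is an injective relabelling of outcomes, so the
    case \<open>g = -f\<close> has the same divergence.\<close>
  have "joint_law f (\<lambda>x. - f x) \<rho> = map_pmf (\<lambda>(u, v). (u, - v)) (joint_law f f \<rho>)" for \<rho>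
    by (simp add: joint_law_def map_pmf_comp case_prod_beta')
  moreover have "inj (\<lambda>(u, v). (u :: real, - v :: real))" by (auto simp: inj_def)
  ultimately have "KL_div (joint_law f (\<lambda>x. - f x) \<rho>0) (joint_law f (\<lambda>x. - f x) \<rho>1) =
      KL_div (joint_law f f \<rho>0) (joint_law f f \<rho>1)"
    using assms(1,2) by (simp add: KL_div_map_pmf_inj set_pmf_joint_law)
  moreover have "KL_div (joint_law f f \<rho>0) (joint_law f f \<rho>1)
      \<le> (MAX k\<in>{1..CARD('n)}. binary_KL_div ((1 + \<rho>0 ^ k) / 2) ((1 + \<rho>1 ^ k) / 2))"
    using assms by (intro KL_div_joint_law_le Max_ge) auto
  ultimately show ?thesis by simp
qed

end
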